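(* For every integer $C\ge 1379$, the maximum number of options in a solvable percentage test of cost $C$ is $$\begin{cases}50\left\lfloor \dfrac{C}{51}\right\rfloor, & C\not\equiv 1 \pmod{51},\\[1.2ex] 50\left(\left\lfloor \dfrac{C}{51}\right\rfloor-1\right), & C\equiv 1 \pmod{51}.\end{cases}$$
   Context: A percentage test is a finite nonempty multiset of positive integers (its answers, or options, interpreted as percentages; order is irrelevant). Its cost is the sum of all answers with multiplicity. Let $K$ be the number of options counted with multiplicity, and let $m_a$ be the number of times the value $a$ appears. A value $a$ appearing in the test is a valid answer if $a=\frac{100\,m_a}{K}$. A test is solvable if it has at least one valid answer. *)

theory Defs
  imports Complex_Main "HOL-Library.Multiset"
begin

definition percentage_test :: "nat multiset \<Rightarrow> bool" where
  "percentage_test T \<longleftrightarrow> T \<noteq> {#} \<and> (\<forall>a\<in>#T. 0 < a)"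

definition cost :: "nat multiset \<Rightarrow> nat" where
  "cost T = sum_mset T"

definition valid_answer :: "nat multiset \<Rightarrow> nat \<Rightarrow> bool" where
  "valid_answer T a \<longleftrightarrow> a \<in># T \<and> real a = 100 * real (count T a) / real (size T)"

definition solvable :: "nat multiset \<Rightarrow> bool" where
  "solvable T \<longleftrightarrow> (\<exists>a. valid_answer T a)"

definition option_counts :: "nat \<Rightarrow> nat set" where
  "option_counts C = {size T | T. percentage_test T \<and> solvable T \<and> cost T = C}"

text \<open>Stated as a predicate rather than with \<^const>\<open>Max\<close>, so that it entails that the
  maximum is attained and needs no separate finiteness or nonemptiness argument.\<close>

definition is_maximum :: "nat set \<Rightarrow> nat \<Rightarrow> bool" where
  "is_maximum S n \<longleftrightarrow> n \<in> S \<and> (\<forall>k\<in>S. k \<le> n)"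

end

theory Submission
  imports Defs
begin

text \<open>
  Let \<open>a\<close> be a valid answer with multiplicity \<open>m\<close> among \<open>K\<close> options, so \<open>100 m = a K\<close>. The
  cheapest way to fill the other \<open>K - m\<close> places is with ones, which costs
  \<open>a m + (K - m) = K (1 + a (a - 1) / 100)\<close> when \<open>a \<ge> 2\<close>. This is least for \<open>a = 2\<close>, where
  \<open>K = 50 m\<close> and the cost is at least \<open>51 m\<close>; hence \<open>m \<le> C div 51\<close>. An excess
  \<open>r = C - 51 m\<close> can be absorbed by raising one of the ones to \<open>1 + r\<close>, unless \<open>r = 1\<close>: raising
  a one to two would change the multiplicity of the valid answer. So an excess of exactly 1 is
  unattainable (\<open>sum_avoiding_two\<close>), and then \<open>m\<close> has to drop by one, which turns the excess
  into 52.

  The remaining valid answers lose to \<open>a = 2\<close>. For \<open>a = 1\<close> the other options are at least 2, so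
  an option costs almost 2 on average, and for \<open>a \<ge> 3\<close> it costs at least \<open>1.06\<close>. Compared with
  \<open>1.02\<close> for \<open>a = 2\<close>, the gap outweighs the rounding losses as soon as \<open>C div 51 \<ge> 27\<close>; the
  tight case is \<open>C mod 51 = 1\<close>, where the maximum is smallest relative to \<open>C\<close>.
\<close>

lemma valid_answer_iff_nat:
  assumes "T \<noteq> {#}"
  shows "valid_answer T a \<longleftrightarrow> a \<in># T \<and> 100 * count T a = a * size T"
proof -
  have "real (size T) > 0"
    using assms by (simp add: nonempty_has_size)
  hence "real a = 100 * real (count T a) / real (size T)
      \<longleftrightarrow> real (100 * count T a) = real (a * size T)"
    by (auto simp: field_simps)
  thus ?thesis
    unfolding valid_answer_def of_nat_eq_iff by simp
qed

lemma size_split_count: "size T = count T a + size {#x \<in># T. x \<noteq> a#}"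
  by (induction T) auto

lemma sum_split_count:
  "sum_mset T = a * count T a + sum_mset {#x \<in># T. x \<noteq> a#}" for T :: "nat multiset"
  by (induction T) auto

lemma sum_mset_ge_mult_size:
  fixes M :: "nat multiset"
  assumes "\<forall>x\<in>#M. b \<le> x"
  shows "b * size M \<le> sum_mset M"
  using assms by (induction M) auto

text \<open>An option exceeding 1 that is not 2 exceeds it by at least 2.\<close>

lemma sum_avoiding_two:
  fixes M :: "nat multiset"
  assumes "\<forall>x\<in>#M. 0 < x \<and> x \<noteq> 2"
  shows "sum_mset M = size M \<or> size M + 2 \<le> sum_mset M"
  using assms by (induction M) auto

text \<open>All options other than the valid answer 2 are ones, except for a single one that absorbs
  the excess cost \<open>r\<close>.\<close>

lemma option_counts_with_answer_two:
  assumes "0 < m" and "r \<noteq> 1"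
  shows "50 * m \<in> option_counts (51 * m + r)"
proof -
  define T where "T = replicate_mset m 2 + replicate_mset (49 * m - 1) 1 + {#1 + r#}"
  have size: "size T = 50 * m"
    using assms by (simp add: T_def)
  have cost: "cost T = 51 * m + r"
    using assms by (simp add: T_def cost_def)
  have test: "percentage_test T"
    by (auto simp: T_def percentage_test_def)
  have "count T 2 = m"
    using assms by (simp add: T_def)
  moreover from this have "2 \<in># T"
    using assms(1) by (simp flip: count_greater_zero_iff)
  ultimately have "valid_answer T 2"
    using test size by (simp add: valid_answer_iff_nat percentage_test_def)
  thus ?thesis
    using test cost size unfolding option_counts_def solvable_def
    by (auto intro!: exI [of _ T])
qed

text \<open>The numerical content of the upper bound: \<open>two\<close> describes the tests with valid answer 2,
  and \<open>costly\<close> bounds all others. The constant 106 is \<open>100 + a (a - 1)\<close> at \<open>a = 3\<close>.\<close>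

lemma option_counts_constraints:
  assumes "K \<in> option_counts C"
  obtains (two) m where "K = 50 * m" "C = 51 * m \<or> 51 * m + 2 \<le> C"
    | (costly) "106 * K \<le> 100 * C"
proof -
  obtain T a where T: "percentage_test T" "valid_answer T a" "cost T = C" "size T = K"
    using assms unfolding option_counts_def solvable_def by blast
  define m where "m = count T a"
  define R where "R = {#x \<in># T. x \<noteq> a#}"
  have "a \<in># T" and answer: "100 * m = a * K"
    using T valid_answer_iff_nat [of T a] by (auto simp: percentage_test_def m_def)
  hence "0 < a"
    using T(1) by (auto simp: percentage_test_def)
  have R_pos: "\<forall>x\<in>#R. 0 < x \<and> x \<noteq> a"
    using T(1) by (auto simp: R_def percentage_test_def)
  have K: "K = m + size R" and C: "C = a * m + sum_mset R"
    using T size_split_count [of T a] sum_split_count [of T a]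
    by (auto simp: m_def R_def cost_def)
  have R_ge: "size R \<le> sum_mset R"
    using sum_mset_ge_mult_size [of R 1] R_pos by fastforce
  consider "a = 1" | "a = 2" | "3 \<le> a"
    using \<open>0 < a\<close> by linarith
  thus thesis
  proof cases
    case 1
    have "2 * size R \<le> sum_mset R"
      using R_pos 1 by (intro sum_mset_ge_mult_size) fastforce
    thus thesis
      using K C answer 1 by (intro costly) simp
  next
    case 2
    show thesis
      using sum_avoiding_two [of R] R_pos K C answer 2 by (intro two [of m]) auto
  next
    case 3
    \<comment> \<open>Here \<open>100 a m - 100 m = (a - 1) a K\<close>, and \<open>(a - 1) a \<ge> 6\<close>.\<close>
    then obtain b where b: "a = b + 3"
      by (metis add.commute le_Suc_ex)
    have "106 * K \<le> 100 * K + (b + 2) * (a * K)"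
      by (simp add: b algebra_simps)
    also have "\<dots> = 100 * K + (b + 2) * (100 * m)"
      by (simp add: answer)
    also have "\<dots> = 100 * (a * m + size R)"
      by (simp add: b K algebra_simps)
    also have "\<dots> \<le> 100 * C"
      using R_ge C by simp
    finally show thesis
      by (rule costly)
  qed
qed

theorem theorem20:
  fixes C :: nat
  assumes "C \<ge> 1379"
  shows "is_maximum (option_counts C)
    (if C mod 51 \<noteq> 1 then 50 * (C div 51) else 50 * (C div 51 - 1))"
proof -
  define q r where "q = C div 51" and "r = C mod 51"
  have C: "C = 51 * q + r" and r: "r < 51"
    by (simp_all add: q_def r_def)
  have q: "27 \<le> q"
    using assms C r by linarith
  have attained: "(if r \<noteq> 1 then 50 * q else 50 * (q - 1)) \<in> option_counts C"
  proof (cases "r = 1")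
    case True
    have "C = 51 * (q - 1) + 52"
      using C True q by simp
    thus ?thesis
      using option_counts_with_answer_two [of "q - 1" 52] True q by simp
  next
    case False
    thus ?thesis
      using option_counts_with_answer_two [of q r] C q by simp
  qed
  have bound: "K \<le> (if r \<noteq> 1 then 50 * q else 50 * (q - 1))" if "K \<in> option_counts C" for K
    using that
  proof (cases rule: option_counts_constraints)
    case (two m)
    have "m \<le> q"
      using two(2) C r by linarith
    moreover have "m \<noteq> q" if "r = 1"
      using two(2) C that by linarith
    ultimately show ?thesis
      using two(1) by auto
  next
    case costly
    thus ?thesis
      using C r q by (cases "r = 1") simp_all
  qed
  show ?thesis
    using attained bound unfolding is_maximum_def q_def r_def by blast
qed

end
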